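(* Let $\mu_1,\dots,\mu_{p+1-\ell}$ be defined by $$\mu_{j-1}:=\frac{1-\alpha_j}{\alpha_{j-1}},\qquad j=2,\dots,p+2-\ell .$$ Let $\mathbf{r}_{\rm loc}=(r_1,\dots,r_{p+2-\ell})^T\in\mathbb{R}^{p+2-\ell}$ be defined by $r_{p+2-\ell}:=\gamma_{\rm loc}\,e_{p+2-\ell}$ and $$r_{j-1}:=-\mu_{j-1}r_j,\qquad j=2,\dots,p+2-\ell,$$ where $$\gamma_{\rm loc}:=\Big(1+e_{p+2-\ell}^2\sum_{j=1}^{p+1-\ell}\frac{1}{e_j^2}\prod_{i=j}^{p+1-\ell}\mu_i^2\Big)^{-1/2}.$$ Then, for all $s=\sum_{i=1}^n c_iB_i\in S$, $$\mathbb{E}_{\Xi,j_0}(s)=|\mathbf{r}_{\rm loc}^T\mathbf{c}_{\rm loc}|,$$ where $\mathbf{c}_{\rm loc}=(c_{i_0-p-1},\dots,c_{i_0-\ell})^T$ and $\mathbb{E}_{\Xi,j_0}(s):=\min_{g\in\hat S}\|g-s\|_\Xi$.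
   Context: Fix a polynomial degree $p\in\mathbb{N}$ (positive integer), breakpoints $a=\zeta_1<\zeta_2<\dots<\zeta_N=b$, and multiplicities $1\le m_j\le p+1$ for $j=2,\dots,N-1$. $S$ is the space of piecewise polynomial functions of degree $\le p$ on these breakpoints having $p-m_j$ continuous derivatives at $\zeta_j$ (no continuity required if $m_j=p+1$); $n:=\dim S=p+1+\sum_{j=2}^{N-1}m_j$. An associated $(p+1)$-basic knot vector is $\Xi=\{\xi_1,\dots,\xi_{n+p+1}\}$ with $\xi_1\le\dots\le\xi_{p+1}=\zeta_1$, followed by each interior breakpoint $\zeta_j$ repeated $m_j$ times in increasing order, followed by $\zeta_N=\xi_{n+1}\le\dots\le\xi_{n+p+1}$. $B_1,\dots,B_n$ is the B-spline basis of degree $p$ of $S$ associated with $\Xi$ (normalized to sum to one on $[a,b]$; $B_i$ is determined by $\xi_i,\dots,\xi_{i+p+1}$). The $\Xi$-norm of $s=\sum_{i=1}^n c_iB_i$ is $\|s\|_\Xi:=\big(\sum_{i=1}^n c_i^2\,\omega_i^2\big)^{1/2}$, where $\omega_i:=\big(\frac{\xi_{i+p+1}-\xi_i}{p+1}\big)^{1/2}$. Fix an interior breakpoint $\zeta_{j_0}$, $2\le j_0\le N-1$, and let $i_0:=p+1+\sum_{j=2}^{j_0}m_j$, so that $\xi_{i_0-1}\le\xi_{i_0}=\zeta_{j_0}<\xi_{i_0+1}$. Put $\ell:=m_{j_0}-1$, so $\ell+1$ is the multiplicity of $\xi_{i_0}$ in $\Xi$. Let $\hat\Xi:=\Xi\setminus\{\xi_{i_0}\}$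 (one occurrence removed), and let $\hat S\subset S$ be the spline space of degree $p$ spanned by the B-splines associated with $\hat\Xi$. For $j=1,\dots,p+2-\ell$ let $$\alpha_j:=\frac{\xi_{i_0}-\xi_{i_0-p-2+j}}{\xi_{i_0-1+j}-\xi_{i_0-p-2+j}},\qquad e_j:=\omega_{i_0-p-2+j}.$$ *)

theory Defs
  imports Complex_Main "HOL-Computational_Algebra.Polynomial"
begin

text \<open>
  All families are indexed from 1 and represented as functions on \<^typ>\<open>nat\<close>; only the
  values at the relevant indices matter. Functions on an interval are represented by total
  functions, of which only the values on that interval matter.
\<close>

definition spline_dim :: "nat \<Rightarrow> nat \<Rightarrow> (nat \<Rightarrow> nat) \<Rightarrow> nat" where
  "spline_dim p N m = p + 1 + (\<Sum>j=2..N-1. m j)"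

text \<open>
  Splines are polynomial on each half-open interval \<open>[\<zeta>\<^sub>j, \<zeta>\<^sub>j\<^sub>+\<^sub>1)\<close>, the last interval being
  closed. The derivatives of order 0 up to \<open>p - m\<^sub>j\<close> are continuous at \<open>\<zeta>\<^sub>j\<close>; there is no such
  order when \<open>m\<^sub>j = p + 1\<close>.
\<close>

definition spline_space ::
    "nat \<Rightarrow> nat \<Rightarrow> (nat \<Rightarrow> real) \<Rightarrow> (nat \<Rightarrow> nat) \<Rightarrow> (real \<Rightarrow> real) set" where
  "spline_space p N \<zeta> m = {s. \<exists>q :: nat \<Rightarrow> real poly.
      (\<forall>j\<in>{1..<N}. degree (q j) \<le> p \<and> (\<forall>x\<in>{\<zeta> j..<\<zeta> (j + 1)}. s x = poly (q j) x)) \<and>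
      s (\<zeta> N) = poly (q (N - 1)) (\<zeta> N) \<and>
      (\<forall>j\<in>{2..<N}. \<forall>k. k + m j \<le> p \<longrightarrow>
         poly ((pderiv ^^ k) (q (j - 1))) (\<zeta> j) = poly ((pderiv ^^ k) (q j)) (\<zeta> j))}"

definition basic_knot_vector ::
    "nat \<Rightarrow> nat \<Rightarrow> (nat \<Rightarrow> real) \<Rightarrow> (nat \<Rightarrow> nat) \<Rightarrow> (nat \<Rightarrow> real) \<Rightarrow> bool" where
  "basic_knot_vector p N \<zeta> m \<xi> \<longleftrightarrow>
     mono_on {1..spline_dim p N m + p + 1} \<xi> \<and>
     \<xi> (p + 1) = \<zeta> 1 \<and>
     (\<forall>j\<in>{2..<N}. \<forall>k\<in>{1..m j}. \<xi> (p + 1 + (\<Sum>i\<in>{2..<j}. m i) + k) = \<zeta> j) \<and>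
     \<xi> (spline_dim p N m + 1) = \<zeta> N"

text \<open>
  Cox--de Boor recursion; terms with denominator 0 vanish because \<open>x / 0 = 0\<close>. B-splines are
  right-continuous to the left of \<open>b\<close>, whereas the value at the right end point \<open>b\<close> is the
  limit from the left.
\<close>

fun bspline :: "real \<Rightarrow> (nat \<Rightarrow> real) \<Rightarrow> nat \<Rightarrow> nat \<Rightarrow> real \<Rightarrow> real" where
  "bspline b \<xi> 0 i x =
     (if x < b then (if \<xi> i \<le> x \<and> x < \<xi> (i + 1) then 1 else 0)
      else (if \<xi> i < x \<and> x \<le> \<xi> (i + 1) then 1 else 0))"
| "bspline b \<xi> (Suc p) i x =
     (x - \<xi> i) / (\<xi> (i + p + 1) - \<xi> i) * bspline b \<xi> p i x +
     (\<xi> (i + p + 2) - x) / (\<xi> (i + p + 2) - \<xi> (i + 1)) * bspline b \<xi> p (i + 1) x"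

text \<open>
  A knot vector \<open>\<xi>\<^sub>1, \<dots>, \<xi>\<^sub>n\<^sub>+\<^sub>p\<^sub>+\<^sub>1\<close> carries \<open>n\<close> B-splines of degree \<open>p\<close>, considered on the basic
  interval \<open>[\<xi>\<^sub>p\<^sub>+\<^sub>1, \<xi>\<^sub>n\<^sub>+\<^sub>1]\<close>.
\<close>

definition has_coeffs ::
    "nat \<Rightarrow> nat \<Rightarrow> (nat \<Rightarrow> real) \<Rightarrow> (real \<Rightarrow> real) \<Rightarrow> (nat \<Rightarrow> real) \<Rightarrow> bool" where
  "has_coeffs p n \<xi> s c \<longleftrightarrow>
     (\<forall>x\<in>{\<xi> (p + 1)..\<xi> (n + 1)}. s x = (\<Sum>i=1..n. c i * bspline (\<xi> (n + 1)) \<xi> p i x))"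

definition bspline_span :: "nat \<Rightarrow> nat \<Rightarrow> (nat \<Rightarrow> real) \<Rightarrow> (real \<Rightarrow> real) set" where
  "bspline_span p n \<xi> = {s. \<exists>c. has_coeffs p n \<xi> s c}"

definition knot_weight :: "nat \<Rightarrow> (nat \<Rightarrow> real) \<Rightarrow> nat \<Rightarrow> real" where
  "knot_weight p \<xi> i = sqrt ((\<xi> (i + p + 1) - \<xi> i) / real (p + 1))"

text \<open>
  Meaningful for functions in the span of the B-splines, whose coefficients with indices
  \<open>1, \<dots>, n\<close> are unique.
\<close>

definition knot_norm :: "nat \<Rightarrow> nat \<Rightarrow> (nat \<Rightarrow> real) \<Rightarrow> (real \<Rightarrow> real) \<Rightarrow> real" where
  "knot_norm p n \<xi> s =
     (let c = (SOME c. has_coeffs p n \<xi> s c)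
      in sqrt (\<Sum>i=1..n. (c i)\<^sup>2 * (knot_weight p \<xi> i)\<^sup>2))"

definition remove_knot :: "nat \<Rightarrow> (nat \<Rightarrow> real) \<Rightarrow> nat \<Rightarrow> real" where
  "remove_knot k \<xi> i = (if i < k then \<xi> i else \<xi> (i + 1))"

definition reduced_space :: "nat \<Rightarrow> nat \<Rightarrow> (nat \<Rightarrow> real) \<Rightarrow> nat \<Rightarrow> (real \<Rightarrow> real) set" where
  "reduced_space p n \<xi> k = bspline_span p (n - 1) (remove_knot k \<xi>)"

text \<open>
  An infimum; that it is a minimum is a property to be established.
\<close>

definition removal_error ::
    "nat \<Rightarrow> nat \<Rightarrow> (nat \<Rightarrow> real) \<Rightarrow> nat \<Rightarrow> (real \<Rightarrow> real) \<Rightarrow> real" where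
  "removal_error p n \<xi> k s = (INF g\<in>reduced_space p n \<xi> k. knot_norm p n \<xi> (\<lambda>x. g x - s x))"

end

theory Submission imports Defs begin

text \<open>
  Let \<open>a\<^sub>i\<close> be Boehm's knot insertion weights. With \<open>\<psi>\<^sub>i(y) = \<Prod>\<^sub>j (y - \<xi>\<^sub>i\<^sub>+\<^sub>j)\<close> one has
  \<open>\<psi>\<^sub>i = a\<^sub>i \<psi>'\<^sub>i + (1 - a\<^sub>i) \<psi>'\<^sub>i\<^sub>-\<^sub>1\<close> for the reduced knots; comparing Marsden's identity
  \<open>\<Sum>\<^sub>i \<psi>\<^sub>i(y) B\<^sub>i(x) = (y - x)^p\<close> for both knot vectors gives
  \<open>B'\<^sub>i = a\<^sub>i B\<^sub>i + (1 - a\<^sub>i\<^sub>+\<^sub>1) B\<^sub>i\<^sub>+\<^sub>1\<close>, because the \<open>\<psi>'\<^sub>i\<close> active on a knot interval are linearly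
  independent. Hence the coefficient vectors of the reduced space are exactly the hyperplane
  orthogonal to a vector \<open>r\<close> with \<open>a\<^sub>i r\<^sub>i + (1 - a\<^sub>i\<^sub>+\<^sub>1) r\<^sub>i\<^sub>+\<^sub>1 = 0\<close>, which is supported on the local
  indices. The constant \<open>\<gamma>\<close> makes \<open>r\<close> a unit vector for the dual weights \<open>1 / \<omega>\<^sub>i\<^sup>2\<close>, so the weighted
  distance to the hyperplane is \<open>\<bar>r \<bullet> c\<bar>\<close>.
\<close>

subsection \<open>Local polynomial pieces and Marsden's identity\<close>

text \<open>
  The polynomial that agrees with the B-spline on the \<open>k\<close>-th knot interval. Below, the
  hypothesis \<open>bspline b \<xi> 0 k x = 1\<close> expresses that \<open>x\<close> lies in the \<open>k\<close>-th knot interval,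
  with the convention of \<open>bspline\<close> at the right end point \<open>b\<close> built in.
\<close>

fun bspline_piece :: "(nat \<Rightarrow> real) \<Rightarrow> nat \<Rightarrow> nat \<Rightarrow> nat \<Rightarrow> real poly" where
  "bspline_piece \<xi> k 0 i = (if i = k then 1 else 0)"
| "bspline_piece \<xi> k (Suc p) i =
     smult (1 / (\<xi> (i + p + 1) - \<xi> i)) ([:- \<xi> i, 1:] * bspline_piece \<xi> k p i) +
     smult (1 / (\<xi> (i + p + 2) - \<xi> (i + 1))) ([:\<xi> (i + p + 2), - 1:] * bspline_piece \<xi> k p (i + 1))"

text \<open>Unrolled from index \<open>i\<close>, the recursion only reaches the degree 0 functions
  with indices \<open>i\<close> to \<open>i + p\<close>. The hypothesis is restricted to these, so
  that it never concerns indices outside the knot vector.\<close>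

lemma bspline_eq_piece:
  assumes "\<And>j. i \<le> j \<Longrightarrow> j \<le> i + p \<Longrightarrow> bspline b \<xi> 0 j x = (if j = k then 1 else 0)"
  shows "bspline b \<xi> p i x = poly (bspline_piece \<xi> k p i) x"
  using assms
proof (induction p arbitrary: i)
  case 0
  show ?case using "0"[of i] by simp
next
  case (Suc p)
  have "bspline b \<xi> p i x = poly (bspline_piece \<xi> k p i) x"
    by (rule Suc.IH, rule Suc.prems) auto
  moreover have "bspline b \<xi> p (i + 1) x = poly (bspline_piece \<xi> k p (i + 1)) x"
    by (rule Suc.IH, rule Suc.prems) auto
  moreover have "(x - c) / d * u + (e - x) / f * v = 1 / d * ((x - c) * u) + 1 / f * ((e - x) * v)"
    for c d e f u v :: real by simp
  ultimately show ?case by (simp add: left_diff_distrib)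
qed

lemma bspline_piece_eq_0: "k < i \<or> i + p < k \<Longrightarrow> bspline_piece \<xi> k p i = 0"
  by (induction p arbitrary: i) auto

text \<open>The \<open>\<psi>\<^sub>i\<close> of Marsden's identity, kept as a polynomial so that
  linear independence can be used.\<close>

definition dual_poly :: "(nat \<Rightarrow> real) \<Rightarrow> nat \<Rightarrow> nat \<Rightarrow> real poly" where
  "dual_poly \<xi> p i = (\<Prod>j\<in>{i+1..i+p}. [:- \<xi> j, 1:])"

text \<open>What nondegeneracy of the \<open>k\<close>-th knot interval yields: the \<open>p\<close>
  knots up to \<open>k\<close> avoid the \<open>p\<close> knots after it. It makes the denominators
  in Marsden's identity nonzero, passes to lower degrees, and is the separation needed for linear
  independence.\<close>

definition knot_split :: "(nat \<Rightarrow> real) \<Rightarrow> nat \<Rightarrow> nat \<Rightarrow> bool" where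
  "knot_split \<xi> p k \<longleftrightarrow> (\<forall>i\<in>{k-p<..k}. \<forall>j\<in>{k<..k+p}. \<xi> i \<noteq> \<xi> j)"

lemma dual_poly_Suc_right: "dual_poly \<xi> (Suc p) i = [:- \<xi> (i + p + 1), 1:] * dual_poly \<xi> p i"
  by (simp add: dual_poly_def)

lemma dual_poly_Suc_left: "dual_poly \<xi> (Suc p) i = [:- \<xi> (i + 1), 1:] * dual_poly \<xi> p (i + 1)"
  unfolding dual_poly_def by (subst prod.atLeast_Suc_atMost) simp_all

text \<open>Induction on the degree. After regrouping by pieces of degree \<open>p\<close>, the two
  products that multiply the \<open>i\<close>-th piece share the factor
  \<open>\<psi>\<^sub>i\<close> of degree \<open>p\<close>, and what remains adds up to
  \<open>y - x\<close>.\<close>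

lemma marsden_piece:
  assumes "k = a + p" "knot_split \<xi> p k"
  shows "(\<Sum>i=a..k. poly (dual_poly \<xi> p i) y * poly (bspline_piece \<xi> k p i) x) = (y - x) ^ p"
  using assms
proof (induction p arbitrary: a)
  case 0
  then show ?case by (simp add: dual_poly_def)
next
  case (Suc p)
  let ?P = "\<lambda>i. poly (bspline_piece \<xi> k p i) x"
  let ?w = "\<lambda>i. (x - \<xi> i) / (\<xi> (i + p + 1) - \<xi> i)"
  let ?v = "\<lambda>i. (\<xi> (i + p + 1) - x) / (\<xi> (i + p + 1) - \<xi> i)"
  let ?D = "\<lambda>p i. poly (dual_poly \<xi> p i) y"
  have k: "k = Suc a + p" using Suc.prems by simp
  have "(\<Sum>i=a..k. ?D (Suc p) i * poly (bspline_piece \<xi> k (Suc p) i) x)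
      = (\<Sum>i=a..k. ?D (Suc p) i * ?w i * ?P i) + (\<Sum>i=a..k. ?D (Suc p) i * ?v (Suc i) * ?P (Suc i))"
    unfolding sum.distrib[symmetric] by (rule sum.cong) (simp_all add: algebra_simps diff_divide_distrib)
  \<comment> \<open>Of degree \<open>p\<close>, only the pieces \<open>Suc a\<close> to
    \<open>k\<close> live on the \<open>k\<close>-th interval: the one with index \<open>a\<close>
    ends before it, the one with index \<open>Suc k\<close> begins after it.\<close>
  also have "(\<Sum>i=a..k. ?D (Suc p) i * ?w i * ?P i) = (\<Sum>i=Suc a..k. ?D (Suc p) i * ?w i * ?P i)"
    using k by (subst sum.atLeast_Suc_atMost) (auto simp: bspline_piece_eq_0)
  also have "(\<Sum>i=a..k. ?D (Suc p) i * ?v (Suc i) * ?P (Suc i))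
      = (\<Sum>i=Suc a..Suc k. ?D (Suc p) (i - 1) * ?v i * ?P i)"
    by (subst sum.shift_bounds_cl_Suc_ivl) simp
  also have "\<dots> = (\<Sum>i=Suc a..k. ?D (Suc p) (i - 1) * ?v i * ?P i)"
    using k by (subst sum.cl_ivl_Suc) (simp add: bspline_piece_eq_0)
  also have "(\<Sum>i=Suc a..k. ?D (Suc p) i * ?w i * ?P i) + \<dots> = (\<Sum>i=Suc a..k. (y - x) * (?D p i * ?P i))"
    unfolding sum.distrib[symmetric]
  proof (rule sum.cong)
    fix i assume i: "i \<in> {Suc a..k}"
    then have ne: "\<xi> (i + p + 1) - \<xi> i \<noteq> 0"
      using Suc.prems(2)[unfolded knot_split_def, rule_format, of i "i + p + 1"] Suc.prems(1) by auto
    have 1: "?D (Suc p) i = (y - \<xi> (i + p + 1)) * ?D p i"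
      by (simp add: dual_poly_Suc_right algebra_simps)
    have 2: "?D (Suc p) (i - 1) = (y - \<xi> i) * ?D p i"
      using i by (cases i) (simp_all add: dual_poly_Suc_left algebra_simps)
    \<comment> \<open>\<open>?w i\<close> and \<open>?v i\<close> are the barycentric coordinates of
      \<open>x\<close> with respect to \<open>\<xi> (i + p + 1)\<close> and
      \<open>\<xi> i\<close>.\<close>
    have "(y - \<xi> (i + p + 1)) * ?w i + (y - \<xi> i) * ?v i = y - x"
      using ne by (simp add: divide_simps) (simp add: algebra_simps)
    moreover have "A * C * w * Q + B * C * v * Q = (A * w + B * v) * (C * Q)" for A B C w v Q :: real
      by (simp add: algebra_simps)
    ultimately show "?D (Suc p) i * ?w i * ?P i + ?D (Suc p) (i - 1) * ?v i * ?P i = (y - x) * (?D p i * ?P i)"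
      unfolding 1 2 by (simp only:)
  qed simp
  also have "\<dots> = (y - x) * (y - x) ^ p"
    unfolding sum_distrib_left[symmetric]
    by (subst Suc.IH[OF k]) (use Suc.prems in \<open>auto simp: knot_split_def\<close>)
  finally show ?case by simp
qed

section \<open>Linear independence of dual polynomials and B-spline pieces\<close>

text \<open>At \<open>f 0\<close> only the summand \<open>q = 0\<close> survives; all others can be divided by \<open>X - f 0\<close>.\<close>

lemma independent_two_sided_products:
  fixes f g d :: "nat \<Rightarrow> real"
  assumes "(\<Sum>q\<le>p. smult (d q) ((\<Prod>j<q. [:- f j, 1:]) * (\<Prod>j<p-q. [:- g j, 1:]))) = 0"
    and "\<And>i j. i < p \<Longrightarrow> j < p \<Longrightarrow> f i \<noteq> g j" and "q \<le> p"
  shows "d q = 0"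
  using assms
proof (induction p arbitrary: f d q)
  case 0
  then show ?case by simp
next
  case (Suc p)
  let ?t = "\<lambda>q. smult (d (Suc q)) ((\<Prod>j<q. [:- f (Suc j), 1:]) * (\<Prod>j<p-q. [:- g j, 1:]))"
  have split: "smult (d 0) (\<Prod>j<Suc p. [:- g j, 1:]) + [:- f 0, 1:] * (\<Sum>q\<le>p. ?t q) = 0"
  proof -
    have "smult (d 0) ((\<Prod>j<0. [:- f j, 1:]) * (\<Prod>j<Suc p-0. [:- g j, 1:]))
        = smult (d 0) (\<Prod>j<Suc p. [:- g j, 1:])" by simp
    moreover have "smult (d (Suc q)) ((\<Prod>j<Suc q. [:- f j, 1:]) * (\<Prod>j<Suc p - Suc q. [:- g j, 1:]))
        = [:- f 0, 1:] * ?t q" for q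
      by (simp only: prod.lessThan_Suc_shift mult_smult_right mult.assoc diff_Suc_Suc)
    ultimately show ?thesis
      using Suc.prems(1) unfolding sum.atMost_Suc_shift by (simp only: sum_distrib_left)
  qed
  have "poly (smult (d 0) (\<Prod>j<Suc p. [:- g j, 1:]) + [:- f 0, 1:] * (\<Sum>q\<le>p. ?t q)) (f 0) = 0"
    unfolding split by simp
  then have "d 0 * (\<Prod>j<Suc p. f 0 - g j) = 0"
    by (simp add: poly_prod algebra_simps)
  moreover have "(\<Prod>j<Suc p. f 0 - g j) \<noteq> 0"
    using Suc.prems(2)[of 0] by (auto simp: prod_zero_iff)
  ultimately have d0: "d 0 = 0" by simp
  then have "(\<Sum>q\<le>p. ?t q) = 0"
    using split by (simp only: smult_0_left add_0 mult_eq_0_iff) simp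
  then have "d (Suc q) = 0" if "q \<le> p" for q
    using Suc.IH[of "\<lambda>q. d (Suc q)" "\<lambda>j. f (Suc j)" q] Suc.prems(2) that by force
  with d0 Suc.prems(3) show ?case by (cases q) auto
qed

text \<open>Counted backwards from \<open>k\<close>, the polynomial with index \<open>k - q\<close>
  has the \<open>q\<close> knots nearest to the interval on its left and the \<open>p - q\<close>
  nearest on its right as zeros. This is the two-sided form.\<close>

lemma independent_dual_poly:
  assumes k: "k = a + p" and "knot_split \<xi> p k"
    and 0: "(\<Sum>i=a..k. smult (d i) (dual_poly \<xi> p i)) = 0" and i: "i \<in> {a..k}"
  shows "d i = 0"
proof -
  have dual: "dual_poly \<xi> p (k - q) = (\<Prod>j<q. [:- \<xi> (k - j), 1:]) * (\<Prod>j<p-q. [:- \<xi> (k + 1 + j), 1:])"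
    if "q \<le> p" for q
  proof -
    have "{k - q + 1..k - q + p} = {k - q + 1..k} \<union> {k + 1..k - q + p}"
      using that k by auto
    then have "dual_poly \<xi> p (k - q)
        = (\<Prod>j\<in>{k - q + 1..k}. [:- \<xi> j, 1:]) * (\<Prod>j\<in>{k + 1..k - q + p}. [:- \<xi> j, 1:])"
      unfolding dual_poly_def by (metis (no_types, lifting) prod.union_disjoint finite_atLeastAtMost
          ivl_disj_int_two(8) Suc_eq_plus1 atLeastSucAtMost_greaterThanAtMost)
    moreover have "(\<Prod>j\<in>{k - q + 1..k}. [:- \<xi> j, 1:]) = (\<Prod>j<q. [:- \<xi> (k - j), 1:])"
      by (rule prod.reindex_bij_witness[of _ "\<lambda>j. k - j" "\<lambda>j. k - j"]) (use that k in auto)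
    moreover have "(\<Prod>j\<in>{k + 1..k - q + p}. [:- \<xi> j, 1:]) = (\<Prod>j<p-q. [:- \<xi> (k + 1 + j), 1:])"
      by (rule prod.reindex_bij_witness[of _ "\<lambda>j. k + 1 + j" "\<lambda>j. j - (k + 1)"]) (use that k in auto)
    ultimately show ?thesis by simp
  qed
  have "(\<Sum>i=a..k. smult (d i) (dual_poly \<xi> p i)) = (\<Sum>q\<le>p. smult (d (k - q)) (dual_poly \<xi> p (k - q)))"
    by (rule sum.reindex_bij_witness[of _ "\<lambda>j. k - j" "\<lambda>j. k - j"]) (use k in auto)
  also have "\<dots> = (\<Sum>q\<le>p. smult (d (k - q))
      ((\<Prod>j<q. [:- \<xi> (k - j), 1:]) * (\<Prod>j<p-q. [:- \<xi> (k + 1 + j), 1:])))"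
    by (rule sum.cong) (use dual in auto)
  finally have "d (k - (k - i)) = 0"
    using 0 assms(2) i k
    by (intro independent_two_sided_products[where d = "\<lambda>q. d (k - q)" and p = p
          and f = "\<lambda>j. \<xi> (k - j)" and g = "\<lambda>j. \<xi> (k + 1 + j)"])
      (auto simp: knot_split_def)
  with i show ?thesis by simp
qed

text \<open>
  The de Boor--Fix functional based at the point 0, where derivatives are multiples of
  coefficients. It maps \<open>(y - X)^p\<close> to \<open>q(y)\<close>, so applied to Marsden's identity it yields
  a basis dual to the B-spline pieces.
\<close>

definition deboor_fix :: "nat \<Rightarrow> real poly \<Rightarrow> real poly \<Rightarrow> real" where
  "deboor_fix p q f = (\<Sum>v\<le>p. (- 1) ^ v / real (p choose v) * coeff q (p - v) * coeff f v)"

lemma deboor_fix_sum: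
  "deboor_fix p q (\<Sum>i\<in>A. smult (c i) (f i)) = (\<Sum>i\<in>A. c i * deboor_fix p q (f i))"
  unfolding deboor_fix_def sum_distrib_left coeff_sum coeff_smult
  by (subst (2) sum.swap) (simp add: mult_ac)

text \<open>The sign and the binomial coefficient in the functional cancel those in the expansion of
  \<open>(y - X)^p\<close>.\<close>

lemma deboor_fix_power:
  assumes "degree q \<le> p"
  shows "deboor_fix p q ([:y, - 1:] ^ p) = poly q y"
proof -
  have "deboor_fix p q ([:y, - 1:] ^ p) = (\<Sum>v\<le>p. coeff q (p - v) * y ^ (p - v))"
    unfolding deboor_fix_def
    by (rule sum.cong) (simp_all add: coeff_linear_poly_power power_mult_distrib[symmetric])
  also have "\<dots> = (\<Sum>v\<le>p. coeff q v * y ^ v)"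
    by (rule sum.reindex_bij_witness[of _ "\<lambda>j. p - j" "\<lambda>j. p - j"]) auto
  also have "\<dots> = poly q y"
    unfolding poly_altdef
    by (rule sum.mono_neutral_right) (use assms in \<open>auto simp: coeff_eq_0\<close>)
  finally show ?thesis .
qed

lemma degree_dual_poly: "degree (dual_poly \<xi> p i) \<le> p"
  unfolding dual_poly_def using degree_prod_sum_le[of "{i+1..i+p}" "\<lambda>j. [:- \<xi> j, 1:]"] by simp

text \<open>Apply the functional \<open>?l\<close> of the \<open>r\<close>-th dual polynomial to
  Marsden's identity: the result is that dual polynomial, expanded in all of them with coefficients
  \<open>?l (?P q)\<close>. Independence forces these to be 1 for \<open>q = r\<close> and 0
  otherwise, so \<open>?l\<close> reads off \<open>c r\<close>.\<close>

lemma independent_bspline_piece: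
  assumes k: "k = a + p" and split: "knot_split \<xi> p k"
    and 0: "(\<Sum>i=a..k. smult (c i) (bspline_piece \<xi> k p i)) = 0" and r: "r \<in> {a..k}"
  shows "c r = 0"
proof -
  let ?l = "deboor_fix p (dual_poly \<xi> p r)" and ?P = "bspline_piece \<xi> k p"
  have "(\<Sum>q=a..k. smult (?l (?P q) - (if q = r then 1 else 0)) (dual_poly \<xi> p q)) = 0"
  proof (rule poly_ext)
    fix y
    have "(\<Sum>q=a..k. smult (poly (dual_poly \<xi> p q) y) (?P q)) = [:y, - 1:] ^ p"
      by (rule poly_ext) (use marsden_piece[OF k split] in \<open>simp add: poly_sum\<close>)
    then have "(\<Sum>q=a..k. poly (dual_poly \<xi> p q) y * ?l (?P q)) = poly (dual_poly \<xi> p r) y"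
      unfolding deboor_fix_sum[symmetric] by (simp add: deboor_fix_power degree_dual_poly)
    moreover have "(\<Sum>q=a..k. (if q = r then 1 else 0) * poly (dual_poly \<xi> p q) y) = poly (dual_poly \<xi> p r) y"
      using r by (simp add: if_distrib[of "\<lambda>c. c * _"] cong: if_cong)
    ultimately show "poly (\<Sum>q=a..k. smult (?l (?P q) - (if q = r then 1 else 0)) (dual_poly \<xi> p q)) y = poly 0 y"
      by (simp only: poly_sum poly_smult left_diff_distrib sum_subtractf mult.commute[of "?l _"]) simp
  qed
  then have l: "?l (?P q) - (if q = r then 1 else 0) = 0" if "q \<in> {a..k}" for q
    by (rule independent_dual_poly[OF k split _ that])
  have "0 = ?l (\<Sum>i=a..k. smult (c i) (?P i))" unfolding 0 by (simp add: deboor_fix_def)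
  also have "\<dots> = (\<Sum>i=a..k. if i = r then c i else 0)"
    unfolding deboor_fix_sum by (rule sum.cong) (use l in \<open>auto split: if_splits\<close>)
  finally show ?thesis using r by simp
qed

section \<open>Knot intervals and the passage from pieces to B-splines\<close>

lemma bspline_0_unique:
  assumes mono: "mono_on {1..K} \<xi>" and k: "bspline b \<xi> 0 k x = 1"
    and "k \<in> {1..<K}" "j \<in> {1..<K}"
  shows "bspline b \<xi> 0 j x = (if j = k then 1 else 0)"
proof -
  have "\<xi> (j + 1) \<le> \<xi> k" if "j < k"
    using mono_onD[OF mono, of "j + 1" k] assms(3,4) that by auto
  moreover have "\<xi> (k + 1) \<le> \<xi> j" if "k < j"
    using mono_onD[OF mono, of "k + 1" j] assms(3,4) that by auto
  ultimately show ?thesis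
    using k by (cases j k rule: linorder_cases) (auto split: if_splits)
qed

lemma bspline_0_exists:
  assumes "lo < hi" and "\<xi> lo < \<xi> hi" and "x \<in> {\<xi> lo..\<xi> hi}"
  shows "\<exists>k\<in>{lo..<hi}. bspline (\<xi> hi) \<xi> 0 k x = 1"
proof -
  \<comment> \<open>Knot \<open>i\<close> lies beyond \<open>x\<close>, in the weak sense at the
    right end point. The interval sought is where this switches from false to true.\<close>
  let ?P = "\<lambda>i. if x < \<xi> hi then x < \<xi> i else x \<le> \<xi> i"
  have "?P hi" "\<not> ?P lo" using assms by auto
  have "\<exists>k\<in>{lo..<hi}. \<not> ?P k \<and> ?P (k + 1)"
  proof (rule ccontr)
    assume no: "\<not> ?thesis"
    have "lo \<le> i \<Longrightarrow> i \<le> hi \<Longrightarrow> \<not> ?P i" for i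
    proof (induction i rule: dec_induct)
      case base
      show ?case by fact
    next
      case (step i)
      then show ?case using no by auto
    qed
    with \<open>?P hi\<close> \<open>lo < hi\<close> show False by auto
  qed
  then obtain k where "k \<in> {lo..<hi}" "\<not> ?P k" "?P (k + 1)" by blast
  then show ?thesis by (intro bexI[of _ k]) (auto split: if_splits)
qed

lemma mono_on_remove_knot:
  assumes "mono_on {1..Suc K} \<xi>"
  shows "mono_on {1..K} (remove_knot r \<xi>)"
  using assms unfolding remove_knot_def
  by (intro mono_onI) (auto intro!: mono_onD[OF assms])

text \<open>Removing knot \<open>r\<close> merges the intervals \<open>r - 1\<close> and
  \<open>r\<close> into one with index \<open>r - 1\<close> and shifts all later ones down.\<close>

lemma bspline_0_remove_knot:
  assumes mono: "mono_on {1..K} \<xi>" and "bspline b \<xi> 0 k x = 1" "1 < r" "r < K" "1 \<le> k"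
  shows "bspline b (remove_knot r \<xi>) 0 (if k < r then k else k - 1) x = 1"
proof -
  have "\<xi> r \<le> \<xi> (r + 1)" "\<xi> (r - 1) \<le> \<xi> r"
    using assms by (auto intro!: mono_onD[OF mono])
  with assms(2-) show ?thesis
    by (cases "k + 1 < r"; cases "k + 1 = r"; cases "k = r")
      (auto simp: remove_knot_def Suc_diff_le split: if_splits)
qed

lemma knot_split_mono:
  assumes mono: "mono_on {1..n + p + 1} \<xi>" and k: "bspline b \<xi> 0 k x = 1" "k \<in> {p + 1..n}"
  shows "knot_split \<xi> p k"
proof -
  have "\<xi> i \<noteq> \<xi> j" if "i \<in> {k-p<..k}" "j \<in> {k<..k+p}" for i j
  proof -
    have "\<xi> i \<le> \<xi> k" "\<xi> (k + 1) \<le> \<xi> j"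
      using that k(2) by (auto intro!: mono_onD[OF mono])
    moreover have "\<xi> k < \<xi> (k + 1)" using k(1) by (auto split: if_splits)
    ultimately show ?thesis by simp
  qed
  then show ?thesis unfolding knot_split_def by blast
qed

lemma bspline_eq_piece_mono:
  assumes "mono_on {1..n + p + 1} \<xi>" "bspline b \<xi> 0 k x = 1" "k \<in> {p + 1..n}" "i \<in> {1..n}"
  shows "bspline b \<xi> p i x = poly (bspline_piece \<xi> k p i) x"
  by (intro bspline_eq_piece bspline_0_unique[OF assms(1,2)]) (use assms(3,4) in auto)

lemma bspline_eq_0:
  assumes "mono_on {1..n + p + 1} \<xi>" "bspline b \<xi> 0 k x = 1" "k \<in> {p + 1..n}" "i \<in> {1..n}"
    and "i \<notin> {k-p..k}"
  shows "bspline b \<xi> p i x = 0"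
proof -
  have "k < i \<or> i + p < k" using assms(5) by (simp, linarith)
  then show ?thesis using bspline_eq_piece_mono[OF assms(1-4)] by (simp add: bspline_piece_eq_0)
qed

lemma marsden:
  assumes "mono_on {1..n + p + 1} \<xi>" "bspline b \<xi> 0 k x = 1" "k \<in> {p + 1..n}"
  shows "(\<Sum>i=1..n. poly (dual_poly \<xi> p i) y * bspline b \<xi> p i x) = (y - x) ^ p"
proof -
  have "(\<Sum>i=1..n. poly (dual_poly \<xi> p i) y * bspline b \<xi> p i x)
      = (\<Sum>i=k-p..k. poly (dual_poly \<xi> p i) y * bspline b \<xi> p i x)"
    by (rule sum.mono_neutral_right) (use assms(3) bspline_eq_0[OF assms] in auto)
  also have "\<dots> = (\<Sum>i=k-p..k. poly (dual_poly \<xi> p i) y * poly (bspline_piece \<xi> k p i) x)"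
    by (rule sum.cong) (use assms(3) bspline_eq_piece_mono[OF assms] in auto)
  also have "\<dots> = (y - x) ^ p"
    by (rule marsden_piece) (use assms(3) knot_split_mono[OF assms] in auto)
  finally show ?thesis .
qed

subsection \<open>Removing a knot\<close>

text \<open>When the end knots differ, the quotient is 1 at \<open>r = i + p + 1\<close> and 0 at
  \<open>r = i\<close>; the first two cases continue it by these constants.\<close>

definition insertion_weight :: "nat \<Rightarrow> (nat \<Rightarrow> real) \<Rightarrow> nat \<Rightarrow> nat \<Rightarrow> real" where
  "insertion_weight p \<xi> r i =
     (if i + p < r then 1 else if r \<le> i then 0 else (\<xi> r - \<xi> i) / (\<xi> (i + p + 1) - \<xi> i))"

text \<open>In the middle case all three polynomials share a factor \<open>D\<close> of degree
  \<open>p - 1\<close>; the remaining zeros are \<open>\<xi> r\<close>,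
  \<open>\<xi> (i + p + 1)\<close> and \<open>\<xi> i\<close>. The weight expresses the first as an
  affine combination of the other two.\<close>

lemma dual_poly_remove_knot:
  assumes "1 \<le> p" "1 \<le> i" and ne: "i < r \<Longrightarrow> r \<le> i + p \<Longrightarrow> \<xi> i \<noteq> \<xi> (i + p + 1)"
  shows "dual_poly \<xi> p i = smult (insertion_weight p \<xi> r i) (dual_poly (remove_knot r \<xi>) p i)
       + smult (1 - insertion_weight p \<xi> r i) (dual_poly (remove_knot r \<xi>) p (i - 1))"
proof -
  consider "i + p < r" | "r \<le> i" | "i < r" "r \<le> i + p" by linarith
  then show ?thesis
  proof cases
    case 1
    then have "dual_poly (remove_knot r \<xi>) p i = dual_poly \<xi> p i"
      unfolding dual_poly_def by (intro prod.cong) (auto simp: remove_knot_def)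
    with 1 show ?thesis by (simp add: insertion_weight_def)
  next
    case 2
    have "dual_poly (remove_knot r \<xi>) p (i - 1) = dual_poly \<xi> p i"
      unfolding dual_poly_def
      by (rule prod.reindex_bij_witness[of _ "\<lambda>j. j - 1" Suc]) (use 2 \<open>1 \<le> i\<close> in \<open>auto simp: remove_knot_def\<close>)
    with 2 show ?thesis by (simp add: insertion_weight_def)
  next
    case 3
    obtain q where p: "p = Suc q" using \<open>1 \<le> p\<close> by (cases p) auto
    define D where "D = dual_poly (remove_knot r \<xi>) q i"
    have 1: "dual_poly (remove_knot r \<xi>) p i = [:- \<xi> (i + p + 1), 1:] * D"
      unfolding p D_def dual_poly_Suc_right using 3 p by (simp add: remove_knot_def)
    have 2: "dual_poly (remove_knot r \<xi>) p (i - 1) = [:- \<xi> i, 1:] * D"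
      unfolding p D_def dual_poly_Suc_left using 3 \<open>1 \<le> i\<close> by (simp add: remove_knot_def)
    have "(\<Prod>j\<in>{i+1..i+p} - {r}. [:- \<xi> j, 1:]) = D"
      unfolding D_def dual_poly_def
      by (rule prod.reindex_bij_witness[of _ "\<lambda>j. if j < r then j else j + 1" "\<lambda>j. if j < r then j else j - 1"])
        (use 3 p in \<open>auto simp: remove_knot_def\<close>)
    then have 0: "dual_poly \<xi> p i = [:- \<xi> r, 1:] * D"
      unfolding dual_poly_def using 3 by (subst prod.remove[of _ r]) auto
    have w: "insertion_weight p \<xi> r i = (\<xi> r - \<xi> i) / (\<xi> (i + p + 1) - \<xi> i)"
      using 3 by (simp add: insertion_weight_def)
    have "[:- \<xi> r, 1:] = smult (insertion_weight p \<xi> r i) [:- \<xi> (i + p + 1), 1:]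
        + smult (1 - insertion_weight p \<xi> r i) [:- \<xi> i, 1:]"
      unfolding w using ne[OF 3] by (simp add: divide_simps) (simp add: algebra_simps)
    then show ?thesis unfolding 0 1 2
      by (simp only: mult_smult_left distrib_right)
  qed
qed

text \<open>Transposition of the knot insertion matrix; the boundary conditions remove
  \<open>u 0\<close> and \<open>u n\<close>. It serves Marsden's identity, the change of
  coefficients, and orthogonality to the normal vector.\<close>

lemma sum_insertion:
  fixes a u B :: "nat \<Rightarrow> real"
  assumes "a 1 = 1" "a n = 0" "1 \<le> n"
  shows "(\<Sum>i=1..n. (a i * u i + (1 - a i) * u (i - 1)) * B i)
       = (\<Sum>i=1..n-1. u i * (a i * B i + (1 - a (i + 1)) * B (i + 1)))"
proof -
  obtain N where n: "n = Suc N" using \<open>1 \<le> n\<close> by (cases n) auto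
  have "(\<Sum>i=1..n. a i * u i * B i) = (\<Sum>i=1..N. a i * u i * B i)"
    using assms by (simp add: n)
  moreover have "(\<Sum>i=1..n. (1 - a i) * u (i - 1) * B i) = (\<Sum>i=Suc 1..Suc N. (1 - a i) * u (i - 1) * B i)"
    unfolding n using assms(1) by (subst sum.atLeast_Suc_atMost) auto
  moreover have "\<dots> = (\<Sum>i=1..N. (1 - a (i + 1)) * u i * B (i + 1))"
    by (subst sum.shift_bounds_cl_Suc_ivl) simp
  ultimately show ?thesis
    by (simp add: n distrib_left distrib_right sum.distrib mult_ac)
qed

lemma bspline_remove_knot:
  assumes mono: "mono_on {1..n + p + 1} \<xi>" and p: "1 \<le> p" and r: "r \<in> {p + 2..n}"
    and ne: "\<And>i. i < r \<Longrightarrow> r \<le> i + p \<Longrightarrow> \<xi> i \<noteq> \<xi> (i + p + 1)"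
    and cell: "bspline b \<xi> 0 k x = 1" and k: "k \<in> {p + 1..n}" and i: "i \<in> {1..n-1}"
  shows "bspline b (remove_knot r \<xi>) p i x = insertion_weight p \<xi> r i * bspline b \<xi> p i x
       + (1 - insertion_weight p \<xi> r (i + 1)) * bspline b \<xi> p (i + 1) x"
proof -
  let ?\<eta> = "remove_knot r \<xi>" and ?a = "insertion_weight p \<xi> r"
  let ?B = "\<lambda>i. bspline b \<xi> p i x" and ?C = "\<lambda>i. bspline b (remove_knot r \<xi>) p i x"
  \<comment> \<open>The interval containing \<open>x\<close> after the removal.\<close>
  define h where "h = (if k < r then k else k - 1)"
  define d where "d i = ?C i - (?a i * ?B i + (1 - ?a (i + 1)) * ?B (i + 1))" for i
  have h: "h \<in> {p + 1..n - 1}" using r k by (auto simp: h_def)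
  have mono': "mono_on {1..n - 1 + p + 1} ?\<eta>"
    by (rule mono_on_remove_knot) (use mono r in simp)
  have cell': "bspline b ?\<eta> 0 h x = 1"
    unfolding h_def by (rule bspline_0_remove_knot[OF mono cell]) (use r k in auto)
  have B0: "?B i = 0" if "i \<in> {1..n}" "k < i \<or> i + p < k" for i
    by (rule bspline_eq_0[OF mono cell k]) (use that in auto)
  have d0: "d i = 0" if "i \<in> {1..n-1}" "i \<notin> {h-p..h}" for i
  proof -
    have i: "1 \<le> i" "i \<le> n" "Suc i \<le> n" using that r by auto
    have C: "?C i = 0" by (rule bspline_eq_0[OF mono' cell' h]) (use that in auto)
    have "h < i \<or> i + p < h" using that(2) by (simp, linarith)
    \<comment> \<open>In the third and fifth case one B-spline is still active at \<open>x\<close>,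
      but its factor vanishes: \<open>?a (i + 1) = 1\<close> if \<open>i + 1 + p = k < r\<close>,
      and \<open>?a i = 0\<close> if \<open>r \<le> k = i\<close>.\<close>
    then consider "k < r" "i > k" | "k < r" "i + 1 + p < k" | "k < r" "i + 1 + p = k"
      | "k \<ge> r" "i > k" | "k \<ge> r" "i = k" | "k \<ge> r" "i + 1 + p < k"
      unfolding h_def by (cases "k < r") (simp_all, linarith+)
    then have "?a i * ?B i = 0 \<and> (1 - ?a (i + 1)) * ?B (i + 1) = 0"
      by cases (use i B0[of i] B0[of "i + 1"] in \<open>auto simp: insertion_weight_def simp del: bspline.simps\<close>)
    then have AB: "?a i * ?B i = 0" "(1 - ?a (i + 1)) * ?B (i + 1) = 0" by blast+
    show ?thesis unfolding d_def C AB by simp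
  qed
  \<comment> \<open>Difference of the Marsden identities for the two knot vectors, with
    \<open>x\<close> fixed and \<open>y\<close> varying.\<close>
  have "(\<Sum>i=1..n-1. d i * poly (dual_poly ?\<eta> p i) y) = 0" for y
  proof -
    let ?D = "\<lambda>i. poly (dual_poly ?\<eta> p i) y"
    have "(y - x) ^ p = (\<Sum>i=1..n. poly (dual_poly \<xi> p i) y * ?B i)"
      by (rule marsden[OF mono cell k, symmetric])
    also have "\<dots> = (\<Sum>i=1..n. (?a i * ?D i + (1 - ?a i) * ?D (i - 1)) * ?B i)"
      by (rule sum.cong[OF refl], subst dual_poly_remove_knot[OF p, where r = r]) (use ne in auto)
    also have "\<dots> = (\<Sum>i=1..n-1. ?D i * (?a i * ?B i + (1 - ?a (i + 1)) * ?B (i + 1)))"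
      by (rule sum_insertion) (use r in \<open>auto simp: insertion_weight_def\<close>)
    finally have "(\<Sum>i=1..n-1. ?D i * ?C i)
        = (\<Sum>i=1..n-1. ?D i * (?a i * ?B i + (1 - ?a (i + 1)) * ?B (i + 1)))"
      unfolding marsden[OF mono' cell' h] by simp
    then show ?thesis
      by (simp only: d_def mult.commute[of _ "?D _"] right_diff_distrib[of "?D _"] sum_subtractf)
  qed
  moreover have "(\<Sum>i=1..n-1. d i * poly (dual_poly ?\<eta> p i) y) = (\<Sum>i=h-p..h. d i * poly (dual_poly ?\<eta> p i) y)" for y
    by (rule sum.mono_neutral_right) (use h d0 in auto)
  ultimately have "(\<Sum>i=h-p..h. smult (d i) (dual_poly ?\<eta> p i)) = 0"
    by (intro poly_ext) (simp add: poly_sum)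
  moreover have "h = h - p + p" using h by auto
  ultimately have "d i = 0"
    using independent_dual_poly[OF _ knot_split_mono[OF mono' cell' h]] d0[OF i] by blast
  then show ?thesis unfolding d_def by simp
qed

text \<open>Knot insertion for coefficients turns membership in the reduced space into a condition
  on coefficient vectors. The out-of-range values \<open>c 0\<close> and \<open>c n\<close> enter
  with factor 0.\<close>

lemma has_coeffs_remove_knot:
  assumes mono: "mono_on {1..n + p + 1} \<xi>" and p: "1 \<le> p" and r: "r \<in> {p + 2..n}"
    and ne: "\<And>i. i < r \<Longrightarrow> r \<le> i + p \<Longrightarrow> \<xi> i \<noteq> \<xi> (i + p + 1)"
    and less: "\<xi> (p + 1) < \<xi> (n + 1)"
  shows "has_coeffs p (n - 1) (remove_knot r \<xi>) g c \<longleftrightarrow>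
    has_coeffs p n \<xi> g (\<lambda>i. insertion_weight p \<xi> r i * c i + (1 - insertion_weight p \<xi> r i) * c (i - 1))"
proof -
  let ?\<eta> = "remove_knot r \<xi>" and ?a = "insertion_weight p \<xi> r"
  have ends: "?\<eta> (p + 1) = \<xi> (p + 1)" "?\<eta> (n - 1 + 1) = \<xi> (n + 1)"
    using r by (auto simp: remove_knot_def)
  have eq: "(\<Sum>i=1..n-1. c i * bspline (\<xi> (n + 1)) ?\<eta> p i x)
      = (\<Sum>i=1..n. (?a i * c i + (1 - ?a i) * c (i - 1)) * bspline (\<xi> (n + 1)) \<xi> p i x)"
    if x: "x \<in> {\<xi> (p + 1)..\<xi> (n + 1)}" for x
  proof -
    have "\<exists>k\<in>{p + 1..<n + 1}. bspline (\<xi> (n + 1)) \<xi> 0 k x = 1"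
      by (rule bspline_0_exists) (use less x r in auto)
    moreover have "{p + 1..<n + 1} = {p + 1..n}" by auto
    ultimately obtain k where k: "k \<in> {p + 1..n}" "bspline (\<xi> (n + 1)) \<xi> 0 k x = 1" by metis
    have "?a 1 = 1" "?a n = 0" "1 \<le> n" using r by (auto simp: insertion_weight_def)
    then have "(\<Sum>i=1..n. (?a i * c i + (1 - ?a i) * c (i - 1)) * bspline (\<xi> (n + 1)) \<xi> p i x)
        = (\<Sum>i=1..n-1. c i * (?a i * bspline (\<xi> (n + 1)) \<xi> p i x
            + (1 - ?a (i + 1)) * bspline (\<xi> (n + 1)) \<xi> p (i + 1) x))"
      by (rule sum_insertion)
    also have "\<dots> = (\<Sum>i=1..n-1. c i * bspline (\<xi> (n + 1)) ?\<eta> p i x)"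
      by (rule sum.cong[OF refl], subst bspline_remove_knot[OF mono p r ne k(2,1)]) auto
    finally show ?thesis ..
  qed
  show ?thesis unfolding has_coeffs_def ends by (intro ball_cong refl) (simp only: eq)
qed

text \<open>On a nondegenerate interval the difference of the two expansions is a polynomial with
  infinitely many zeros, hence zero, and the pieces active there are independent.\<close>

lemma has_coeffs_unique:
  assumes mono: "mono_on {1..n + p + 1} \<xi>"
    and c: "has_coeffs p n \<xi> s c" and d: "has_coeffs p n \<xi> s d"
    and k: "k \<in> {p + 1..n}" "\<xi> k < \<xi> (k + 1)" and i: "i \<in> {k-p..k}"
  shows "c i = d i"
proof -
  let ?b = "\<xi> (n + 1)"
  have le: "\<xi> (p + 1) \<le> \<xi> k" "\<xi> (k + 1) \<le> ?b"
    using k by (auto intro!: mono_onD[OF mono])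
  have "poly (\<Sum>j=k-p..k. smult (c j - d j) (bspline_piece \<xi> k p j)) x = 0"
    if x: "x \<in> {\<xi> k..<\<xi> (k + 1)}" for x
  proof -
    have cell: "bspline ?b \<xi> 0 k x = 1" using x le by auto
    have "(\<Sum>j=1..n. (c j - d j) * bspline ?b \<xi> p j x) = 0"
      using c d x le unfolding has_coeffs_def by (simp add: left_diff_distrib sum_subtractf)
    moreover have "(\<Sum>j=1..n. (c j - d j) * bspline ?b \<xi> p j x)
        = (\<Sum>j=k-p..k. (c j - d j) * bspline ?b \<xi> p j x)"
      by (rule sum.mono_neutral_right) (use k bspline_eq_0[OF mono cell k(1)] in auto)
    moreover have "\<dots> = (\<Sum>j=k-p..k. (c j - d j) * poly (bspline_piece \<xi> k p j) x)"
      by (rule sum.cong) (use k bspline_eq_piece_mono[OF mono cell k(1)] in auto)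
    ultimately show ?thesis by (simp add: poly_sum)
  qed
  then have "{\<xi> k..<\<xi> (k + 1)} \<subseteq> {x. poly (\<Sum>j=k-p..k. smult (c j - d j) (bspline_piece \<xi> k p j)) x = 0}"
    by (intro subsetI CollectI)
  then have "infinite {x. poly (\<Sum>j=k-p..k. smult (c j - d j) (bspline_piece \<xi> k p j)) x = 0}"
    by (rule infinite_super[OF _ infinite_Ico[OF k(2)]])
  then have "(\<Sum>j=k-p..k. smult (c j - d j) (bspline_piece \<xi> k p j)) = 0"
    using poly_roots_finite by blast
  moreover have "bspline ?b \<xi> 0 k (\<xi> k) = 1" using k le by auto
  moreover have "k = k - p + p" using k by auto
  ultimately have "c i - d i = 0"
    using independent_bspline_piece[of k "k - p" p \<xi> "\<lambda>j. c j - d j", OF _ knot_split_mono[OF mono _ k(1)] _ i]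
    by blast
  then show ?thesis by simp
qed

subsection \<open>Distance to the reduced space\<close>

text \<open>Orthogonality is necessary by transposition. Conversely, the equations before
  \<open>t\<close> are solved forward by dividing by \<open>a i\<close>, and those after
  \<open>t\<close> read \<open>c i = d (i - 1)\<close>. The one left, at \<open>t\<close>, follows
  from orthogonality because \<open>\<rho> t \<noteq> 0\<close>.\<close>

lemma insertion_range_iff:
  fixes a \<rho> c :: "nat \<Rightarrow> real"
  assumes a1: "a 1 = 1" and t: "t \<in> {1..n}" "\<rho> t \<noteq> 0"
    and lt: "\<And>i. i \<in> {1..<t} \<Longrightarrow> a i \<noteq> 0" and ge: "\<And>i. i \<in> {t..n} \<Longrightarrow> a i = 0"
    and \<rho>: "\<And>i. i \<in> {1..<n} \<Longrightarrow> a i * \<rho> i + (1 - a (i + 1)) * \<rho> (i + 1) = 0"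
  shows "(\<exists>d. \<forall>i\<in>{1..n}. c i = a i * d i + (1 - a i) * d (i - 1)) \<longleftrightarrow> (\<Sum>i=1..n. \<rho> i * c i) = 0"
proof -
  have orth: "(\<Sum>i=1..n. \<rho> i * (a i * d i + (1 - a i) * d (i - 1))) = 0" for d
  proof -
    have "(\<Sum>i=1..n. (a i * d i + (1 - a i) * d (i - 1)) * \<rho> i)
        = (\<Sum>i=1..n-1. d i * (a i * \<rho> i + (1 - a (i + 1)) * \<rho> (i + 1)))"
      by (rule sum_insertion) (use a1 t ge in auto)
    also have "\<dots> = 0" by (rule sum.neutral) (use \<rho> in auto)
    finally show ?thesis by (simp add: mult.commute)
  qed
  show ?thesis
  proof
    assume "\<exists>d. \<forall>i\<in>{1..n}. c i = a i * d i + (1 - a i) * d (i - 1)"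
    then obtain d where d: "\<forall>i\<in>{1..n}. c i = a i * d i + (1 - a i) * d (i - 1)" by blast
    have "(\<Sum>i=1..n. \<rho> i * c i) = (\<Sum>i=1..n. \<rho> i * (a i * d i + (1 - a i) * d (i - 1)))"
      by (rule sum.cong) (use d in auto)
    then show "(\<Sum>i=1..n. \<rho> i * c i) = 0" using orth by simp
  next
    assume c: "(\<Sum>i=1..n. \<rho> i * c i) = 0"
    \<comment> \<open>The start value is arbitrary: \<open>d 0\<close> only meets the factor
      \<open>1 - a 1 = 0\<close>.\<close>
    define d where "d = rec_nat 0
      (\<lambda>i x. if Suc i < t then (c (Suc i) - (1 - a (Suc i)) * x) / a (Suc i) else c (Suc (Suc i)))"
    have d: "d (Suc i) = (if Suc i < t then (c (Suc i) - (1 - a (Suc i)) * d i) / a (Suc i) else c (Suc (Suc i)))" for i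
      by (simp add: d_def)
    have "t \<noteq> 1" using a1 ge[of 1] t by auto
    have eq: "c i = a i * d i + (1 - a i) * d (i - 1)" if i: "i \<in> {1..n}" "i \<noteq> t" for i
    proof (cases "i < t")
      case True
      then show ?thesis using i lt[of i] d[of "i - 1"] by (simp add: field_simps)
    next
      case False
      then have "a i = 0" using i ge by simp
      moreover obtain k where "i = Suc (Suc k)"
        using False i t \<open>t \<noteq> 1\<close> by (cases i; cases "i - 1") auto
      ultimately show ?thesis using False i d[of k] by simp
    qed
    have "0 = (\<Sum>i=1..n. \<rho> i * (c i - (a i * d i + (1 - a i) * d (i - 1))))"
      using c orth[of d] by (simp add: right_diff_distrib sum_subtractf)
    also have "\<dots> = \<rho> t * (c t - (a t * d t + (1 - a t) * d (t - 1)))"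
      by (subst sum.remove[OF _ t(1)]) (use eq in \<open>auto intro!: sum.neutral\<close>)
    finally have "c t = a t * d t + (1 - a t) * d (t - 1)" using t(2) by simp
    with eq show "\<exists>d. \<forall>i\<in>{1..n}. c i = a i * d i + (1 - a i) * d (i - 1)" by metis
  qed
qed

text \<open>The foot of the perpendicular from \<open>c\<close> is
  \<open>c - S \<rho> / w\<^sup>2\<close>, at distance \<open>\<bar>S\<bar>\<close>. The lower bound
  comes from expanding the squared distance from \<open>d\<close> to this foot, which equals that
  from \<open>d\<close> to \<open>c\<close> minus \<open>S\<^sup>2\<close>.\<close>

lemma hyperplane_weighted_distance:
  fixes \<rho> w c d :: "'i \<Rightarrow> real"
  assumes w: "\<forall>i\<in>I. w i \<noteq> 0" and unit: "(\<Sum>i\<in>I. (\<rho> i)\<^sup>2 / (w i)\<^sup>2) = 1"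
  defines "S \<equiv> \<Sum>i\<in>I. \<rho> i * c i"
  shows "(\<Sum>i\<in>I. \<rho> i * d i) = 0 \<Longrightarrow> \<bar>S\<bar> \<le> sqrt (\<Sum>i\<in>I. (d i - c i)\<^sup>2 * (w i)\<^sup>2)"
    and "(\<Sum>i\<in>I. \<rho> i * (c i - S * \<rho> i / (w i)\<^sup>2)) = 0"
    and "sqrt (\<Sum>i\<in>I. ((c i - S * \<rho> i / (w i)\<^sup>2) - c i)\<^sup>2 * (w i)\<^sup>2) = \<bar>S\<bar>"
proof -
  have sq: "(S * \<rho> i / (w i)\<^sup>2)\<^sup>2 * (w i)\<^sup>2 = S\<^sup>2 * ((\<rho> i)\<^sup>2 / (w i)\<^sup>2)" if "i \<in> I" for i
    using w that by (simp add: power2_eq_square field_simps)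
  then have "(\<Sum>i\<in>I. (S * \<rho> i / (w i)\<^sup>2)\<^sup>2 * (w i)\<^sup>2) = (\<Sum>i\<in>I. S\<^sup>2 * ((\<rho> i)\<^sup>2 / (w i)\<^sup>2))"
    by (rule sum.cong[OF refl])
  then have norm: "(\<Sum>i\<in>I. (S * \<rho> i / (w i)\<^sup>2)\<^sup>2 * (w i)\<^sup>2) = S\<^sup>2"
    unfolding sum_distrib_left[symmetric] unit by simp
  then show "sqrt (\<Sum>i\<in>I. ((c i - S * \<rho> i / (w i)\<^sup>2) - c i)\<^sup>2 * (w i)\<^sup>2) = \<bar>S\<bar>"
    by simp
  have "(\<Sum>i\<in>I. \<rho> i * (c i - S * \<rho> i / (w i)\<^sup>2)) = (\<Sum>i\<in>I. \<rho> i * c i - S * ((\<rho> i)\<^sup>2 / (w i)\<^sup>2))"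
    by (rule sum.cong) (simp_all add: power2_eq_square algebra_simps)
  also have "\<dots> = 0"
    unfolding sum_subtractf sum_distrib_left[symmetric] unit S_def by simp
  finally show "(\<Sum>i\<in>I. \<rho> i * (c i - S * \<rho> i / (w i)\<^sup>2)) = 0" .
  assume d: "(\<Sum>i\<in>I. \<rho> i * d i) = 0"
  have "0 \<le> (\<Sum>i\<in>I. (d i - c i + S * \<rho> i / (w i)\<^sup>2)\<^sup>2 * (w i)\<^sup>2)"
    by (intro sum_nonneg) simp
  also have "\<dots> = (\<Sum>i\<in>I. (d i - c i)\<^sup>2 * (w i)\<^sup>2 + 2 * S * (\<rho> i * d i - \<rho> i * c i)
      + (S * \<rho> i / (w i)\<^sup>2)\<^sup>2 * (w i)\<^sup>2)"
    by (rule sum.cong[OF refl]) (use w in \<open>simp add: power2_eq_square field_simps\<close>)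
  also have "\<dots> = (\<Sum>i\<in>I. (d i - c i)\<^sup>2 * (w i)\<^sup>2) - S\<^sup>2"
    unfolding sum.distrib norm sum_distrib_left[symmetric] sum_subtractf d S_def[symmetric]
    by (simp add: power2_eq_square)
  finally show "\<bar>S\<bar> \<le> sqrt (\<Sum>i\<in>I. (d i - c i)\<^sup>2 * (w i)\<^sup>2)"
    by (intro real_le_rsqrt) simp
qed

text \<open>By \<open>cells\<close> every B-spline is active on a nondegenerate interval, so the
  coefficients chosen in \<open>knot_norm\<close> are unique and can be replaced by any known
  ones.\<close>

lemma knot_norm_eq:
  assumes mono: "mono_on {1..n + p + 1} \<xi>"
    and cells: "\<And>i. i \<in> {1..n} \<Longrightarrow> \<exists>k\<in>{p + 1..n}. i \<in> {k-p..k} \<and> \<xi> k < \<xi> (k + 1)"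
    and d: "has_coeffs p n \<xi> f d"
  shows "knot_norm p n \<xi> f = sqrt (\<Sum>i=1..n. (d i)\<^sup>2 * (knot_weight p \<xi> i)\<^sup>2)"
proof -
  define c where "c = (SOME c. has_coeffs p n \<xi> f c)"
  have c: "has_coeffs p n \<xi> f c"
    unfolding c_def by (rule someI[of "has_coeffs p n \<xi> f", OF d])
  have "c i = d i" if "i \<in> {1..n}" for i
    using cells[OF that] has_coeffs_unique[OF mono c d] by blast
  then show ?thesis
    unfolding knot_norm_def c_def[symmetric] Let_def by simp
qed

lemma knot_less:
  fixes \<xi> :: "nat \<Rightarrow> real"
  assumes mono: "mono_on {1..n + p + 1} \<xi>"
    and cells: "\<And>i. i \<in> {1..n} \<Longrightarrow> \<exists>k\<in>{p + 1..n}. i \<in> {k-p..k} \<and> \<xi> k < \<xi> (k + 1)"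
    and i: "i \<in> {1..n}"
  shows "\<xi> i < \<xi> (i + p + 1)"
proof -
  obtain k where k: "k \<in> {p + 1..n}" "i \<in> {k-p..k}" "\<xi> k < \<xi> (k + 1)" using cells[OF i] by blast
  have "\<xi> i \<le> \<xi> k" "\<xi> (k + 1) \<le> \<xi> (i + p + 1)"
    using k i by (auto intro!: mono_onD[OF mono])
  with k(3) show ?thesis by simp
qed

text \<open>Reduces the approximation problem to the distance from \<open>c\<close> to a hyperplane;
  \<open>t\<close> is the index from which the insertion weights vanish.\<close>

lemma removal_error_hyperplane:
  assumes mono: "mono_on {1..n + p + 1} \<xi>" and p: "1 \<le> p" and r: "r \<in> {p + 2..n}"
    and cells: "\<And>i. i \<in> {1..n} \<Longrightarrow> \<exists>k\<in>{p + 1..n}. i \<in> {k-p..k} \<and> \<xi> k < \<xi> (k + 1)"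
    and t: "t \<in> {1..n}" "\<rho> t \<noteq> 0"
    and lt: "\<And>i. i \<in> {1..<t} \<Longrightarrow> insertion_weight p \<xi> r i \<noteq> 0"
    and ge: "\<And>i. i \<in> {t..n} \<Longrightarrow> insertion_weight p \<xi> r i = 0"
    and \<rho>: "\<And>i. i \<in> {1..<n} \<Longrightarrow>
      insertion_weight p \<xi> r i * \<rho> i + (1 - insertion_weight p \<xi> r (i + 1)) * \<rho> (i + 1) = 0"
    and unit: "(\<Sum>i=1..n. (\<rho> i)\<^sup>2 / (knot_weight p \<xi> i)\<^sup>2) = 1"
    and s: "has_coeffs p n \<xi> s c"
  shows "(\<exists>g\<in>reduced_space p n \<xi> r. knot_norm p n \<xi> (\<lambda>x. g x - s x) = removal_error p n \<xi> r s)
    \<and> removal_error p n \<xi> r s = \<bar>\<Sum>i=1..n. \<rho> i * c i\<bar>"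
proof -
  let ?w = "knot_weight p \<xi>" and ?a = "insertion_weight p \<xi> r"
  let ?f = "\<lambda>g. knot_norm p n \<xi> (\<lambda>x. g x - s x)"
  define S where "S = (\<Sum>i=1..n. \<rho> i * c i)"
  have less: "\<xi> i < \<xi> (i + p + 1)" if i: "i \<in> {1..n}" for i
    by (rule knot_less[OF mono _ i]) (rule cells)
  have ends: "\<xi> (p + 1) < \<xi> (n + 1)"
  proof -
    have "n \<in> {1..n}" using r by auto
    then obtain k where k: "k \<in> {p + 1..n}" "\<xi> k < \<xi> (k + 1)" using cells by blast
    have "\<xi> (p + 1) \<le> \<xi> k" "\<xi> (k + 1) \<le> \<xi> (n + 1)"
      using k by (auto intro!: mono_onD[OF mono])
    with k(2) show ?thesis by simp
  qed
  have w: "\<forall>i\<in>{1..n}. ?w i \<noteq> 0"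
  proof
    fix i assume "i \<in> {1..n}"
    from less[OF this] show "?w i \<noteq> 0" by (simp add: knot_weight_def)
  qed
  have ne: "\<xi> i \<noteq> \<xi> (i + p + 1)" if "i < r" "r \<le> i + p" for i
    using less[of i] that r by auto
  note coeffs = has_coeffs_remove_knot[OF mono p r ne ends]
  have a1: "?a 1 = 1" using r by (simp add: insertion_weight_def)
  have range: "(\<exists>d. \<forall>i\<in>{1..n}. x i = ?a i * d i + (1 - ?a i) * d (i - 1)) \<longleftrightarrow> (\<Sum>i=1..n. \<rho> i * x i) = 0" for x
    by (rule insertion_range_iff) (fact a1 t lt ge \<rho>)+
  note dist = hyperplane_weighted_distance[where c = c, OF w unit, folded S_def]
  have norm: "?f g = sqrt (\<Sum>i=1..n. (d i - c i)\<^sup>2 * (?w i)\<^sup>2)" if "has_coeffs p n \<xi> g d" for g d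
    by (rule knot_norm_eq[OF mono cells])
      (use that s in \<open>auto simp: has_coeffs_def left_diff_distrib sum_subtractf simp del: bspline.simps\<close>)
  have lower: "\<bar>S\<bar> \<le> ?f g" if g: "g \<in> reduced_space p n \<xi> r" for g
  proof -
    obtain d where "has_coeffs p (n - 1) (remove_knot r \<xi>) g d"
      using g unfolding reduced_space_def bspline_span_def by blast
    then have *: "has_coeffs p n \<xi> g (\<lambda>i. ?a i * d i + (1 - ?a i) * d (i - 1))"
      by (simp only: coeffs)
    have "(\<Sum>i=1..n. \<rho> i * (?a i * d i + (1 - ?a i) * d (i - 1))) = 0"
      by (subst range[symmetric]) blast
    then show ?thesis unfolding norm[OF *] by (rule dist(1))
  qed
  \<comment> \<open>The foot of the perpendicular lies in the hyperplane, so it comes from reduced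
    coefficients \<open>d\<close>; the spline with these is the minimizer.\<close>
  obtain d where d: "\<forall>i\<in>{1..n}. c i - S * \<rho> i / (?w i)\<^sup>2 = ?a i * d i + (1 - ?a i) * d (i - 1)"
    using dist(2) range[of "\<lambda>i. c i - S * \<rho> i / (?w i)\<^sup>2"] by blast
  define g where "g x = (\<Sum>i=1..n-1. d i * bspline (remove_knot r \<xi> (n - 1 + 1)) (remove_knot r \<xi>) p i x)" for x
  have g: "has_coeffs p (n - 1) (remove_knot r \<xi>) g d"
    by (simp add: has_coeffs_def g_def)
  then have gR: "g \<in> reduced_space p n \<xi> r"
    unfolding reduced_space_def bspline_span_def by blast
  have "?f g = sqrt (\<Sum>i=1..n. ((?a i * d i + (1 - ?a i) * d (i - 1)) - c i)\<^sup>2 * (?w i)\<^sup>2)"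
    by (rule norm) (use g in \<open>simp only: coeffs\<close>)
  also have "\<dots> = sqrt (\<Sum>i=1..n. ((c i - S * \<rho> i / (?w i)\<^sup>2) - c i)\<^sup>2 * (?w i)\<^sup>2)"
    using d by (intro arg_cong[of _ _ sqrt] sum.cong) auto
  also have "\<dots> = \<bar>S\<bar>" by (rule dist(3))
  finally have fg: "?f g = \<bar>S\<bar>" .
  have "removal_error p n \<xi> r s = \<bar>S\<bar>"
    unfolding removal_error_def by (rule cInf_eq_minimum) (use fg gR lower in force)+
  with fg gR show ?thesis unfolding S_def by auto
qed

subsection \<open>Structure of basic knot vectors\<close>

text \<open>The index of the last knot in front of the block of knots equal to \<open>\<zeta>\<^sub>j\<close>.\<close>

definition block_start :: "nat \<Rightarrow> (nat \<Rightarrow> nat) \<Rightarrow> nat \<Rightarrow> nat" where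
  "block_start p m j = p + 1 + (\<Sum>i\<in>{2..<j}. m i)"

lemma block_start_Suc: "2 \<le> j \<Longrightarrow> block_start p m (Suc j) = block_start p m j + m j"
  by (simp add: block_start_def)

lemma block_start_mono: "i \<le> j \<Longrightarrow> block_start p m i \<le> block_start p m j"
  by (auto simp: block_start_def intro!: sum_mono2)

lemma block_start_last: "2 \<le> N \<Longrightarrow> block_start p m N = spline_dim p N m"
proof -
  assume "2 \<le> N"
  then have "{2..<N} = {2..N - 1}" by auto
  then show ?thesis by (simp add: block_start_def spline_dim_def)
qed

text \<open>Locates the jump from one breakpoint to the next. Interior blocks are nonempty because
  \<open>1 \<le> m j\<close>; the outer cases come from \<open>\<xi> (p + 1)\<close> and
  \<open>\<xi> (n + 1)\<close>.\<close>

lemma knot_block_start: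
  assumes knots: "basic_knot_vector p N \<zeta> m \<xi>"
    and m: "\<And>j. j \<in> {2..N-1} \<Longrightarrow> 1 \<le> m j" and j: "j \<in> {2..N}"
  shows "\<xi> (block_start p m j) = \<zeta> (j - 1)" "\<xi> (block_start p m j + 1) = \<zeta> j"
proof -
  have block: "\<xi> (block_start p m i + k) = \<zeta> i" if "i \<in> {2..<N}" "k \<in> {1..m i}" for i k
    using knots that unfolding basic_knot_vector_def block_start_def by blast
  show "\<xi> (block_start p m j) = \<zeta> (j - 1)"
  proof (cases "j = 2")
    case True
    then show ?thesis using knots by (simp add: block_start_def basic_knot_vector_def)
  next
    case False
    then have "block_start p m j = block_start p m (j - 1) + m (j - 1)"
      using block_start_Suc[of "j - 1" p m] j by (cases j) auto
    moreover have "\<xi> (block_start p m (j - 1) + m (j - 1)) = \<zeta> (j - 1)"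
    proof (rule block)
      show "j - 1 \<in> {2..<N}" using False j by auto
      then show "m (j - 1) \<in> {1..m (j - 1)}" using m[of "j - 1"] by auto
    qed
    ultimately show ?thesis by simp
  qed
  show "\<xi> (block_start p m j + 1) = \<zeta> j"
  proof (cases "j = N")
    case True
    then show ?thesis using knots j by (simp add: block_start_last basic_knot_vector_def)
  next
    case False
    then show ?thesis using block[of j 1] j m[of j] by auto
  qed
qed

text \<open>Consecutive block starts are at most \<open>p + 1\<close> apart, so one of them falls
  among \<open>i\<close> to \<open>i + p\<close>; there the knots jump.\<close>

lemma knot_cell_exists:
  assumes knots: "basic_knot_vector p N \<zeta> m \<xi>" and \<zeta>: "strict_mono_on {1..N} \<zeta>"
    and m: "\<And>j. j \<in> {2..N-1} \<Longrightarrow> 1 \<le> m j \<and> m j \<le> p + 1"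
    and p: "1 \<le> p" and N: "2 \<le> N" and i: "i \<in> {1..spline_dim p N m}"
  shows "\<exists>k\<in>{p + 1..spline_dim p N m}. i \<in> {k-p..k} \<and> \<xi> k < \<xi> (k + 1)"
proof -
  let ?T = "block_start p m"
  have m1: "1 \<le> m j" if "j \<in> {2..N-1}" for j using m[OF that] by simp
  have "\<exists>j\<in>{2..N}. i \<le> ?T j \<and> ?T j \<le> i + p"
  proof (cases "i \<le> p + 1")
    case True
    then show ?thesis using N i by (intro bexI[of _ 2]) (auto simp: block_start_def)
  next
    case False
    define j where "j = (LEAST j. i \<le> ?T j)"
    have TN: "i \<le> ?T N" using i block_start_last[OF N] by simp
    have ij: "i \<le> ?T j" unfolding j_def using TN by (rule LeastI)
    have jN: "j \<le> N" unfolding j_def using TN by (rule Least_le)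
    have "\<not> j \<le> 2"
      using block_start_mono[of j 2 p m] ij False by (auto simp: block_start_def)
    then have j: "2 \<le> j - 1" "Suc (j - 1) = j" by auto
    have "\<not> i \<le> ?T (j - 1)"
      unfolding j_def by (rule not_less_Least) (use j in \<open>simp add: j_def[symmetric]\<close>)
    moreover have "?T j = ?T (j - 1) + m (j - 1)" using block_start_Suc[OF j(1)] j(2) by simp
    moreover have "m (j - 1) \<le> p + 1" using m[of "j - 1"] j jN by auto
    ultimately have "?T j \<le> i + p" by linarith
    then show ?thesis using ij jN j by (intro bexI[of _ j]) auto
  qed
  then obtain j where j: "j \<in> {2..N}" "i \<le> ?T j" "?T j \<le> i + p" by blast
  have "\<zeta> (j - 1) < \<zeta> j"
    by (rule strict_mono_onD[OF \<zeta>]) (use j in auto)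
  then have "\<xi> (?T j) < \<xi> (?T j + 1)"
    by (simp only: knot_block_start[OF knots m1 j(1)])
  moreover have "?T j \<in> {p + 1..spline_dim p N m}"
    using block_start_mono[of j N p m] block_start_last[OF N, of p m] j(1) by (auto simp: block_start_def)
  ultimately show ?thesis using j by (intro bexI[of _ "?T j"]) auto
qed

subsection \<open>The unit normal vector\<close>

text \<open>Unrolling the recursion gives \<open>r j\<close> squared as a product of
  \<open>\<mu>\<close> squared times the last square. With \<open>X\<close> the bracket in
  \<open>\<gamma>\<close>, the first \<open>M\<close> terms sum to
  \<open>\<gamma>\<^sup>2 * (X - 1)\<close> and the last one is
  \<open>\<gamma>\<^sup>2\<close>.\<close>

lemma normal_vector_unit:
  fixes r \<mu> e :: "nat \<Rightarrow> real"
  assumes "\<gamma> = (1 + (e (Suc M))\<^sup>2 * (\<Sum>j=1..M. 1 / (e j)\<^sup>2 * (\<Prod>i=j..M. (\<mu> i)\<^sup>2))) powr (- 1 / 2)"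
    and e: "e (Suc M) \<noteq> 0" and last: "r (Suc M) = \<gamma> * e (Suc M)"
    and rec: "\<And>j. j \<in> {1..M} \<Longrightarrow> r j = - \<mu> j * r (Suc j)"
  shows "(\<Sum>j=1..Suc M. (r j)\<^sup>2 / (e j)\<^sup>2) = 1" "r (Suc M) \<noteq> 0"
proof -
  define X where "X = 1 + (e (Suc M))\<^sup>2 * (\<Sum>j=1..M. 1 / (e j)\<^sup>2 * (\<Prod>i=j..M. (\<mu> i)\<^sup>2))"
  have "0 \<le> (\<Sum>j=1..M. 1 / (e j)\<^sup>2 * (\<Prod>i=j..M. (\<mu> i)\<^sup>2))"
    by (intro sum_nonneg mult_nonneg_nonneg prod_nonneg) auto
  then have X: "X > 0" unfolding X_def by (simp add: add_pos_nonneg)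
  have "\<gamma> = X powr (- 1 / 2)" unfolding X_def by fact
  moreover have "X powr (- 1 / 2) * X powr (- 1 / 2) = 1 / X"
    using X by (simp add: powr_add[symmetric] powr_minus_divide)
  ultimately have \<gamma>: "\<gamma>\<^sup>2 * X = 1" "\<gamma> \<noteq> 0" using X by (auto simp: power2_eq_square)
  show "r (Suc M) \<noteq> 0" using last e \<gamma> by simp
  have sq: "(r j)\<^sup>2 = (\<Prod>i=j..M. (\<mu> i)\<^sup>2) * (r (Suc M))\<^sup>2" if "1 \<le> j" "j \<le> Suc M" for j
    using that(2,1)
  proof (induction rule: inc_induct)
    case base
    show ?case by simp
  next
    case (step j)
    then show ?case
      using rec[of j] by (simp add: prod.atLeast_Suc_atMost[of j M] power_mult_distrib)
  qed
  have "(\<Sum>j=1..Suc M. (r j)\<^sup>2 / (e j)\<^sup>2) = (\<Sum>j=1..M. (r j)\<^sup>2 / (e j)\<^sup>2) + \<gamma>\<^sup>2"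
    using e last by (simp add: power_mult_distrib)
  also have "(\<Sum>j=1..M. (r j)\<^sup>2 / (e j)\<^sup>2)
      = (\<Sum>j=1..M. \<gamma>\<^sup>2 * (e (Suc M))\<^sup>2 * (1 / (e j)\<^sup>2 * (\<Prod>i=j..M. (\<mu> i)\<^sup>2)))"
    by (rule sum.cong) (auto simp: sq last power_mult_distrib)
  also have "\<dots> = \<gamma>\<^sup>2 * (X - 1)"
    unfolding sum_distrib_left[symmetric] X_def by simp
  finally show "(\<Sum>j=1..Suc M. (r j)\<^sup>2 / (e j)\<^sup>2) = 1"
    using \<gamma> by (simp add: algebra_simps)
qed

section \<open>The local vector as unit normal of the reduced space\<close>

theorem theorem3p5:
  fixes p N n j0 i0 l :: nat
    and m :: "nat \<Rightarrow> nat"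
    and \<zeta> \<xi> \<alpha> e \<mu> r c :: "nat \<Rightarrow> real"
    and \<gamma> :: real
    and s :: "real \<Rightarrow> real"
  assumes p: "p \<ge> 1"
    and breakpoints: "strict_mono_on {1..N} \<zeta>"
    and multiplicities: "\<And>j. j \<in> {2..N-1} \<Longrightarrow> 1 \<le> m j \<and> m j \<le> p + 1"
    and n: "n = spline_dim p N m"
    and knots: "basic_knot_vector p N \<zeta> m \<xi>"
    and j0: "2 \<le> j0" "j0 \<le> N - 1"
    and i0: "i0 = p + 1 + (\<Sum>j=2..j0. m j)"
    and l: "l = m j0 - 1"
    and \<alpha>: "\<And>j. j \<in> {1..p+2-l} \<Longrightarrow>
          \<alpha> j = (\<xi> i0 - \<xi> (i0 - p - 2 + j)) / (\<xi> (i0 - 1 + j) - \<xi> (i0 - p - 2 + j))"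
    and e: "\<And>j. j \<in> {1..p+2-l} \<Longrightarrow> e j = knot_weight p \<xi> (i0 - p - 2 + j)"
    and \<mu>: "\<And>j. j \<in> {2..p+2-l} \<Longrightarrow> \<mu> (j - 1) = (1 - \<alpha> j) / \<alpha> (j - 1)"
    and \<gamma>: "\<gamma> = (1 + (e (p+2-l))\<^sup>2 *
          (\<Sum>j=1..p+1-l. 1 / (e j)\<^sup>2 * (\<Prod>i=j..p+1-l. (\<mu> i)\<^sup>2))) powr (- 1 / 2)"
    and r_last: "r (p+2-l) = \<gamma> * e (p+2-l)"
    and r_rec: "\<And>j. j \<in> {2..p+2-l} \<Longrightarrow> r (j - 1) = - \<mu> (j - 1) * r j"
    and s: "s \<in> spline_space p N \<zeta> m" "has_coeffs p n \<xi> s c"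
  shows "(\<exists>g\<in>reduced_space p n \<xi> i0. knot_norm p n \<xi> (\<lambda>x. g x - s x) = removal_error p n \<xi> i0 s)
       \<and> removal_error p n \<xi> i0 s = \<bar>\<Sum>j=1..p+2-l. r j * c (i0 - p - 2 + j)\<bar>"
proof -
  let ?a = "insertion_weight p \<xi> i0" and ?M = "p + 1 - l" and ?h = "\<lambda>j. i0 - p - 2 + j"
  \<comment> \<open>\<open>r\<close> extended by zero; local index 1 sits at
    \<open>i0 - p - 1\<close>.\<close>
  define \<rho> where "\<rho> i = (if i \<in> {i0-p-1..i0-l} then r (i - (i0 - p - 2)) else 0)" for i
  have N: "2 \<le> N" and j0N: "j0 \<in> {2..N-1}" "j0 \<in> {2..N}" "Suc j0 \<in> {2..N}" using j0 by auto
  have m1: "1 \<le> m j" if "j \<in> {2..N-1}" for j using multiplicities[OF that] by simp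
  have lp: "l \<le> p" and ml: "m j0 = Suc l" using multiplicities[OF j0N(1)] l by auto
  have M: "p + 2 - l = Suc ?M" using lp by simp
  have mono: "mono_on {1..n + p + 1} \<xi>"
    using knots unfolding basic_knot_vector_def n by blast
  have i0_start: "i0 = block_start p m (Suc j0)"
    unfolding i0 block_start_def by (simp add: atLeastLessThanSuc_atLeastAtMost)
  then have i0_prev: "i0 = block_start p m j0 + Suc l"
    using block_start_Suc[OF j0(1), of p m] ml by simp
  have i0_lower: "i0 - Suc l \<ge> p + 1" using i0_prev by (simp add: block_start_def)
  have i0n: "i0 \<le> n"
    using block_start_mono[of "Suc j0" N p m] j0N(3) block_start_last[OF N, of p m] i0_start n by simp
  have r: "i0 \<in> {p + 2..n}" using i0_lower i0n by auto
  note next_knot = knot_block_start[OF knots m1 j0N(3), folded i0_start]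
  note prev_knot = knot_block_start[OF knots m1 j0N(2)]
  have start: "block_start p m j0 = i0 - Suc l" "i0 - Suc l + 1 = i0 - l" using i0_prev by auto
  have \<xi>_eq: "\<xi> (i0 - l) = \<xi> i0" and \<xi>_less: "\<xi> (i0 - Suc l) < \<xi> i0"
    using prev_knot next_knot(1) strict_mono_onD[OF breakpoints, of "j0 - 1" j0] j0N
    unfolding start by auto
  have cells: "\<exists>k\<in>{p + 1..n}. i \<in> {k-p..k} \<and> \<xi> k < \<xi> (k + 1)" if "i \<in> {1..n}" for i
    using knot_cell_exists[OF knots breakpoints multiplicities p N] that unfolding n by blast
  have less: "\<xi> i < \<xi> (i + p + 1)" if i: "i \<in> {1..n}" for i
    by (rule knot_less[OF mono _ i]) (rule cells)
  \<comment> \<open>The knots \<open>i0 - l\<close> to \<open>i0\<close> coincide, so the numerator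
    of the weight vanishes from the first of them on. Hence \<open>i0 - l\<close> takes the role of
    \<open>t\<close>.\<close>
  have a0: "?a i = 0" if "i \<in> {i0-l..n}" for i
  proof (cases "i0 \<le> i")
    case False
    have "\<xi> (i0 - l) \<le> \<xi> i" "\<xi> i \<le> \<xi> i0"
      using that False r lp by (auto intro!: mono_onD[OF mono])
    moreover have "\<not> i + p < i0" using that lp by auto
    ultimately show ?thesis using False \<xi>_eq by (simp add: insertion_weight_def)
  qed (simp add: insertion_weight_def)
  have a_ne: "?a i \<noteq> 0" if "i \<in> {1..<i0-l}" for i
  proof -
    have "\<xi> i \<le> \<xi> (i0 - Suc l)"
      using that r by (auto intro!: mono_onD[OF mono])
    then show ?thesis using that less[of i] \<xi>_less r by (auto simp: insertion_weight_def)
  qed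
  \<comment> \<open>The quotient \<open>\<alpha>\<close> also covers the ends of the window: it is 1
    at \<open>j = 1\<close>, and 0 where the index reaches \<open>i0\<close>, which happens only for
    \<open>l = 0\<close>.\<close>
  have a_\<alpha>: "?a (?h j) = \<alpha> j" if j: "j \<in> {1..Suc ?M}" for j
  proof -
    have \<alpha>j: "\<alpha> j = (\<xi> i0 - \<xi> (?h j)) / (\<xi> (i0 - 1 + j) - \<xi> (?h j))"
      using \<alpha>[of j] j M by simp
    have idx: "?h j + p + 1 = i0 - 1 + j" using r by auto
    consider "j = 1" | "j \<noteq> 1" "?h j < i0" | "?h j = i0" using j r by fastforce
    then show ?thesis
    proof cases
      case 1
      then have i0j: "i0 - 1 + j = i0" using r by auto
      have "\<xi> (?h j) < \<xi> i0"
        using less[of "?h j"] r 1 unfolding idx i0j by auto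
      then have "\<alpha> j = 1" unfolding \<alpha>j i0j by simp
      with 1 r show ?thesis by (auto simp: insertion_weight_def)
    next
      case 2
      then have "\<not> ?h j + p < i0" "\<not> i0 \<le> ?h j" using j r by auto
      then show ?thesis unfolding \<alpha>j idx[symmetric] by (simp only: insertion_weight_def if_False)
    next
      case 3
      with \<alpha>j show ?thesis by (simp add: insertion_weight_def)
    qed
  qed
  have \<rho>_h: "\<rho> (?h j) = r j" if "j \<in> {1..Suc ?M}" for j
  proof -
    have "?h j \<in> {i0-p-1..i0-l}" using that r lp by auto
    then show ?thesis by (simp only: \<rho>_def if_True diff_add_inverse)
  qed
  have local_sum: "(\<Sum>i=1..n. f i) = (\<Sum>j=1..Suc ?M. f (?h j))"
    if "\<And>i. \<rho> i = 0 \<Longrightarrow> f i = 0" for f :: "nat \<Rightarrow> real"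
  proof -
    have "(\<Sum>i=1..n. f i) = (\<Sum>i=i0-p-1..i0-l. f i)"
      by (rule sum.mono_neutral_right) (use that r in \<open>auto simp: \<rho>_def\<close>)
    also have "\<dots> = (\<Sum>j=1..Suc ?M. f (?h j))"
      by (rule sum.reindex_bij_witness[of _ ?h "\<lambda>i. i - (i0 - p - 2)"]) (use r lp in auto)
    finally show ?thesis .
  qed
  have h_last: "?h (Suc ?M) = i0 - l" and last_in: "i0 - l \<in> {1..n}" using r lp by auto
  have "e (Suc ?M) = knot_weight p \<xi> (i0 - l)"
    using e[of "Suc ?M"] M unfolding h_last by simp
  then have e_ne: "e (Suc ?M) \<noteq> 0"
    using less[OF last_in] by (simp add: knot_weight_def)
  have "r j = - \<mu> j * r (Suc j)" if "j \<in> {1..?M}" for j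
    using r_rec[of "Suc j"] that M by simp
  note unit = normal_vector_unit[OF \<gamma>[unfolded M] e_ne r_last[unfolded M] this]
  have "(\<Sum>i=1..n. (\<rho> i)\<^sup>2 / (knot_weight p \<xi> i)\<^sup>2) = (\<Sum>j=1..Suc ?M. (r j)\<^sup>2 / (e j)\<^sup>2)"
    by (subst local_sum, simp, rule sum.cong[OF refl]) (use e M \<rho>_h in auto)
  then have \<rho>_unit: "(\<Sum>i=1..n. (\<rho> i)\<^sup>2 / (knot_weight p \<xi> i)\<^sup>2) = 1"
    using unit(1) by simp
  have t: "\<rho> (i0 - l) \<noteq> 0"
    using \<rho>_h[of "Suc ?M"] unit(2) unfolding h_last by simp
  have \<rho>_rec: "?a i * \<rho> i + (1 - ?a (i + 1)) * \<rho> (i + 1) = 0" if i: "i \<in> {1..<n}" for i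
  proof -
    \<comment> \<open>At the two ends of the support of \<open>\<rho>\<close> the weights close the
      relation: \<open>1 - ?a (i + 1) = 0\<close> just before it and \<open>?a i = 0\<close> at its
      last index. In between it is the recursion for \<open>r\<close>.\<close>
    consider "i + 1 < i0 - p - 1" | "i + 1 = i0 - p - 1" | "i0 - l \<le> i" | "i0 - p - 1 \<le> i" "i < i0 - l"
      by linarith
    then show ?thesis
    proof cases
      case 1
      then show ?thesis by (simp add: \<rho>_def)
    next
      case 2
      then have "?a (i + 1) = 1" by (simp add: insertion_weight_def)
      with 2 show ?thesis by (simp add: \<rho>_def)
    next
      case 3
      then have "?a i = 0" using i a0[of i] by simp
      moreover have "\<rho> (i + 1) = 0" using 3 by (simp add: \<rho>_def)
      ultimately show ?thesis by simp
    next
      case 4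
      define j where "j = i - (i0 - p - 2)"
      have j: "j \<in> {1..?M}" "i = ?h j" "i + 1 = ?h (Suc j)" using 4 r lp by (auto simp: j_def)
      have "\<mu> j = (1 - \<alpha> (Suc j)) / \<alpha> j" "r j = - \<mu> j * r (Suc j)"
        using \<mu>[of "Suc j"] r_rec[of "Suc j"] j(1) M by auto
      moreover have "\<alpha> j \<noteq> 0" using a_ne[of i] 4 i a_\<alpha>[of j] j by auto
      ultimately have "\<alpha> j * r j + (1 - \<alpha> (Suc j)) * r (Suc j) = 0" by simp
      moreover have "?a i = \<alpha> j" "\<rho> i = r j"
        using a_\<alpha>[of j] \<rho>_h[of j] j(1) unfolding j(2)[symmetric] by simp_all
      moreover have "?a (i + 1) = \<alpha> (Suc j)" "\<rho> (i + 1) = r (Suc j)"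
        using a_\<alpha>[of "Suc j"] \<rho>_h[of "Suc j"] j(1) unfolding j(3)[symmetric] by simp_all
      ultimately show ?thesis by (simp only:)
    qed
  qed
  have sum_eq: "(\<Sum>i=1..n. \<rho> i * c i) = (\<Sum>j=1..p+2-l. r j * c (?h j))"
    unfolding M by (subst local_sum, simp, rule sum.cong[OF refl]) (use \<rho>_h in auto)
  show ?thesis
    unfolding sum_eq[symmetric]
    by (rule removal_error_hyperplane[OF mono p r cells last_in t a_ne a0 \<rho>_rec \<rho>_unit s(2)])
qed

end
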